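(* Let $\mathcal{A}=\bigcup_\alpha X_\alpha$ be a unital strong algebra such that the topology on $\mathcal{A}$ is the finest topology for which the mappings $X_\alpha\hookrightarrow\mathcal{A}$ are continuous. Then the set of invertible elements $GL(\mathcal{A})$ is open in $\mathcal{A}$, and the map $(\cdot)^{-1}:GL(\mathcal{A})\to GL(\mathcal{A})$ is continuous.
   Context: Inductive limit of Banach spaces: a vector space $X$ with a family $\{X_\alpha:\alpha\in A\}$ of subspaces, $X_\alpha\ne X_\beta$ for $\alpha\neq\beta$, directed under inclusion, with $X=\bigcup_\alpha X_\alpha$; the index set $A$ is directed by $\alpha\le\beta$ iff $X_\alpha\subseteq X_\beta$. Each $X_\alpha$ is a Banach space with norm $\|\cdot\|_\alpha$, and whenever $\alpha\le\beta$ the topology induced by $\|\cdot\|_\beta$ on $X_\alpha$ is coarser than that induced by $\|\cdot\|_\alpha$. $X$ carries the inductive limit topology: the finest locally convex topology making all inclusions $X_\alpha\hookrightarrow X$ continuous. Strong algebra: an inductive limit $\mathcal{A}=\bigcup_{\alpha\in A} X_\alpha$ of Banach spaces which is also an (associative) algebra such that for any $\alpha\in A$ there exists $h(\alpha)\in A$ such that for any $\beta\ge h(\alpha)$ there is a positive constant $A_{\beta,\alpha}$ with $\|ab\|_\beta\le A_{\beta,\alpha}\|a\|_\alpha\|b\|_\beta$ and $\|ba\|_\beta\le A_{\beta,\alpha}\|a\|_\alpha\|b\|_\beta$ for every $a\in X_\alpha$, $b\in X_\beta$. Unital means that $\mathcal{A}$ has a multiplicative unit $1$. The hypothesis of the theorem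 says that the inductive limit (finest locally convex) topology coincides with the finest among all topologies (not necessarily locally convex) making all the inclusions continuous, i.e. $U\subseteq\mathcal{A}$ is open iff $U\cap X_\alpha$ is open in $X_\alpha$ for every $\alpha$. *)

theory Defs
  imports "HOL-Analysis.Analysis"
begin

definition finest_topology :: "('a topology \<Rightarrow> bool) \<Rightarrow> 'a topology \<Rightarrow> bool" where
  "finest_topology P T \<longleftrightarrow> P T \<and> (\<forall>T'. P T' \<longrightarrow> (\<forall>U. openin T' U \<longrightarrow> openin T U))"

text \<open>
  The scalar field is any \<open>real_normed_field\<close>, so that the real and the complex case are both
  covered; the real number \<open>t\<close> acts as \<open>of_real t\<close>.
\<close>

definition convex_wrt :: "('k::real_normed_field \<Rightarrow> 'a::ab_group_add \<Rightarrow> 'a) \<Rightarrow> 'a set \<Rightarrow> bool" where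
  "convex_wrt smul S \<longleftrightarrow>
     (\<forall>x\<in>S. \<forall>y\<in>S. \<forall>t::real. 0 \<le> t \<and> t \<le> 1 \<longrightarrow>
        smul (of_real (1 - t)) x + smul (of_real t) y \<in> S)"

text \<open>Hausdorffness is not part of the definition of a locally convex topology.\<close>

definition locally_convex_topology ::
  "('k::real_normed_field \<Rightarrow> 'a::ab_group_add \<Rightarrow> 'a) \<Rightarrow> 'a topology \<Rightarrow> bool" where
  "locally_convex_topology smul T \<longleftrightarrow>
     topspace T = UNIV \<and>
     continuous_map (prod_topology T T) T (\<lambda>(x, y). x + y) \<and>
     continuous_map (prod_topology euclidean T) T (\<lambda>(c, x). smul c x) \<and>
     (\<forall>U. openin T U \<and> 0 \<in> U \<longrightarrow>
        (\<exists>V W. openin T V \<and> 0 \<in> V \<and> V \<subseteq> W \<and> W \<subseteq> U \<and> convex_wrt smul W))"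

text \<open>
  A norm on a subspace \<open>S\<close> is a function on the whole type whose values outside \<open>S\<close> are
  irrelevant. The distance is set to \<open>0\<close> outside \<open>S\<close> only because the locale \<^locale>\<open>Metric_space\<close>
  wants non-negativity and symmetry on the whole type.
\<close>

definition norm_dist :: "'a::ab_group_add set \<Rightarrow> ('a \<Rightarrow> real) \<Rightarrow> 'a \<Rightarrow> 'a \<Rightarrow> real" where
  "norm_dist S n x y = (if x \<in> S \<and> y \<in> S then n (x - y) else 0)"

definition norm_topology :: "'a::ab_group_add set \<Rightarrow> ('a \<Rightarrow> real) \<Rightarrow> 'a topology" where
  "norm_topology S n = Metric_space.mtopology S (norm_dist S n)"

definition banach_on ::
  "('k::real_normed_field \<Rightarrow> 'a::ab_group_add \<Rightarrow> 'a) \<Rightarrow> 'a set \<Rightarrow> ('a \<Rightarrow> real) \<Rightarrow> bool" where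
  "banach_on smul S n \<longleftrightarrow>
     module.subspace smul S \<and>
     (\<forall>x\<in>S. 0 \<le> n x \<and> (n x = 0 \<longleftrightarrow> x = 0)) \<and>
     (\<forall>c. \<forall>x\<in>S. n (smul c x) = norm c * n x) \<and>
     (\<forall>x\<in>S. \<forall>y\<in>S. n (x + y) \<le> n x + n y) \<and>
     Metric_space.mcomplete S (norm_dist S n)"

lemma Metric_space_norm_dist:
  fixes smul :: "'k::real_normed_field \<Rightarrow> 'a::ab_group_add \<Rightarrow> 'a"
  assumes "vector_space smul" "banach_on smul S n"
  shows "Metric_space S (norm_dist S n)"
proof -
  interpret vector_space smul by fact
  have sub: "subspace S"
    and nn: "\<And>x. x \<in> S \<Longrightarrow> 0 \<le> n x" "\<And>x. x \<in> S \<Longrightarrow> n x = 0 \<longleftrightarrow> x = 0"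
    and hom: "\<And>c x. x \<in> S \<Longrightarrow> n (smul c x) = norm c * n x"
    and tri: "\<And>x y. x \<in> S \<Longrightarrow> y \<in> S \<Longrightarrow> n (x + y) \<le> n x + n y"
    using assms(2) by (auto simp: banach_on_def)
  have diff: "x - y \<in> S" if "x \<in> S" "y \<in> S" for x y
    using sub that by (rule subspace_diff)
  show ?thesis
  proof
    fix x y z
    show "0 \<le> norm_dist S n x y"
      using nn diff by (simp add: norm_dist_def)
    show "norm_dist S n x y = norm_dist S n y x"
      using hom[of "y - x" "-1"] diff by (auto simp: norm_dist_def)
    show "norm_dist S n x y = 0 \<longleftrightarrow> x = y" if "x \<in> S" "y \<in> S"
      using nn diff that by (simp add: norm_dist_def)
    show "norm_dist S n x z \<le> norm_dist S n x y + norm_dist S n y z"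
      if "x \<in> S" "y \<in> S" "z \<in> S"
      using tri[of "x - y" "y - z"] diff that by (simp add: norm_dist_def)
  qed
qed

definition inclusions_continuous ::
  "'i set \<Rightarrow> ('i \<Rightarrow> 'a::ab_group_add set) \<Rightarrow> ('i \<Rightarrow> 'a \<Rightarrow> real) \<Rightarrow> 'a topology \<Rightarrow> bool" where
  "inclusions_continuous I X N T \<longleftrightarrow>
     topspace T = UNIV \<and>
     (\<forall>\<alpha>\<in>I. continuous_map (norm_topology (X \<alpha>) (N \<alpha>)) T (\<lambda>x. x))"

locale banach_inductive_limit = vector_space smul
  for smul :: "'k::real_normed_field \<Rightarrow> 'a::ab_group_add \<Rightarrow> 'a" +
  fixes I :: "'i set"
    and X :: "'i \<Rightarrow> 'a set"
    and N :: "'i \<Rightarrow> 'a \<Rightarrow> real"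
    and T :: "'a topology"
  assumes banach: "\<alpha> \<in> I \<Longrightarrow> banach_on smul (X \<alpha>) (N \<alpha>)"
    and distinct: "inj_on X I"
    and directed: "\<lbrakk>\<alpha> \<in> I; \<beta> \<in> I\<rbrakk> \<Longrightarrow> \<exists>\<gamma>\<in>I. X \<alpha> \<subseteq> X \<gamma> \<and> X \<beta> \<subseteq> X \<gamma>"
    and union: "(\<Union>\<alpha>\<in>I. X \<alpha>) = UNIV"
    and coarser: "\<lbrakk>\<alpha> \<in> I; \<beta> \<in> I; X \<alpha> \<subseteq> X \<beta>;
        openin (subtopology (norm_topology (X \<beta>) (N \<beta>)) (X \<alpha>)) U\<rbrakk> \<Longrightarrow>
        openin (norm_topology (X \<alpha>) (N \<alpha>)) U"
    and inductive_limit_topology: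
      "finest_topology
         (\<lambda>T'. locally_convex_topology smul T' \<and> inclusions_continuous I X N T') T"

text \<open>
  The inequalities between norms presuppose that the products \<open>a * b\<close> and \<open>b * a\<close> lie in \<open>X \<beta>\<close>.
\<close>

locale strong_algebra = banach_inductive_limit smul I X N T
  for smul :: "'k::real_normed_field \<Rightarrow> 'a::ring \<Rightarrow> 'a"
    and I :: "'i set" and X N T +
  assumes scale_mult_left: "smul c a * b = smul c (a * b)"
    and scale_mult_right: "a * smul c b = smul c (a * b)"
    and strong: "\<alpha> \<in> I \<Longrightarrow>
      \<exists>h\<in>I. \<forall>\<beta>\<in>I. X h \<subseteq> X \<beta> \<longrightarrow>
        (\<exists>C>0. \<forall>a\<in>X \<alpha>. \<forall>b\<in>X \<beta>.
           a * b \<in> X \<beta> \<and> N \<beta> (a * b) \<le> C * N \<alpha> a * N \<beta> b \<and>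
           b * a \<in> X \<beta> \<and> N \<beta> (b * a) \<le> C * N \<alpha> a * N \<beta> b)"

text \<open>
  The unit is an explicit element because the class \<^class>\<open>ring_1\<close> would exclude the zero algebra.
\<close>

locale unital_strong_algebra = strong_algebra smul I X N T
  for smul :: "'k::real_normed_field \<Rightarrow> 'a::ring \<Rightarrow> 'a"
    and I :: "'i set" and X N T +
  fixes e :: 'a
  assumes unit_left: "e * a = a"
    and unit_right: "a * e = a"

definition GL :: "'a::ring \<Rightarrow> 'a set" where
  "GL e = {a. \<exists>b. a * b = e \<and> b * a = e}"

definition inverse_wrt :: "'a::ring \<Rightarrow> 'a \<Rightarrow> 'a" where
  "inverse_wrt e a = (THE b. a * b = e \<and> b * a = e)"

end

theory Submission
  imports Defs
begin

text \<open>
  Let \<open>a\<close> be invertible with inverse \<open>b\<close>. An element \<open>z\<close> is a right inverse of \<open>a + d\<close> exactly when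
  \<open>z = b - (b d) z\<close>, and a left inverse exactly when \<open>z = b - z (d b)\<close>. These are fixed point
  equations of affine maps. If \<open>d\<close> runs through a small ball of one step \<open>X \<alpha>\<close>, a first use of the
  strong algebra inequality makes \<open>b d\<close> and \<open>d b\<close> small in the norm of some \<open>X \<beta>\<close>, and a second
  use makes multiplication by them a contraction of a larger step \<open>X \<eta>\<close> that contains \<open>b\<close>. Banach's
  fixed point theorem in \<open>X \<eta>\<close> then gives both one-sided inverses, hence \<open>(a + d)\<inverse>\<close>, together with
  the estimate that \<open>(a + d)\<inverse>\<close> is within \<open>O(\<parallel>d\<parallel>\<^sub>\<alpha>)\<close> of \<open>b\<close> in the norm of \<open>X \<eta>\<close>. This is
  \<open>inverse_of_perturbation\<close>; it plays the role of the Neumann series.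

  The step \<open>X \<eta>\<close> depends on \<open>a\<close> and on \<open>\<alpha>\<close>, so the estimate is local and says nothing about
  neighbourhoods in the limit by itself. This is where the hypothesis on the topology enters: a set
  is open as soon as its trace on every step is open, so that perturbations \<open>d\<close> from one step at a
  time suffice.
\<close>

section \<open>Open sets of the steps and of the limit\<close>

text \<open>
  The default value \<open>0\<close> of \<^const>\<open>norm_dist\<close> outside of the subspace disappears here, since open
  sets of the subspace are described by increments that lie in the subspace.
\<close>

lemma openin_norm_topology:
  fixes smul :: "'k::real_normed_field \<Rightarrow> 'a::ab_group_add \<Rightarrow> 'a"
  assumes vs: "vector_space smul" and bn: "banach_on smul S n"
  shows "openin (norm_topology S n) U \<longleftrightarrow>
    U \<subseteq> S \<and> (\<forall>x\<in>U. \<exists>r>0. \<forall>d\<in>S. n d < r \<longrightarrow> x + d \<in> U)"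
proof -
  interpret vector_space smul by (rule vs)
  interpret M: Metric_space S "norm_dist S n" by (rule Metric_space_norm_dist[OF vs bn])
  have sub: "subspace S" and hom: "\<And>c x. x \<in> S \<Longrightarrow> n (smul c x) = norm c * n x"
    using bn by (auto simp: banach_on_def)
  have minus: "n (- x) = n x" if "x \<in> S" for x
    using hom[of x "-1"] that by simp
  have ball: "M.mball x r \<subseteq> U \<longleftrightarrow> (\<forall>d\<in>S. n d < r \<longrightarrow> x + d \<in> U)" if x: "x \<in> S" for x r
  proof
    assume L: "M.mball x r \<subseteq> U"
    show "\<forall>d\<in>S. n d < r \<longrightarrow> x + d \<in> U"
    proof (intro ballI impI)
      fix d assume d: "d \<in> S" "n d < r"
      have "x + d \<in> M.mball x r"
        using d x minus subspace_add[OF sub] by (simp add: norm_dist_def)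
      then show "x + d \<in> U" using L by blast
    qed
  next
    assume R: "\<forall>d\<in>S. n d < r \<longrightarrow> x + d \<in> U"
    show "M.mball x r \<subseteq> U"
    proof
      fix y assume "y \<in> M.mball x r"
      then have y: "y \<in> S" "n (x - y) < r" using x by (auto simp: norm_dist_def)
      have "y - x \<in> S" using subspace_diff[OF sub] x y by blast
      moreover have "n (y - x) < r" using y minus[OF calculation] by simp
      ultimately show "y \<in> U" using R by force
    qed
  qed
  show ?thesis
    unfolding norm_topology_def M.openin_mtopology using ball by blast
qed

text \<open>
  Openness of the traces is stable under finite intersections and arbitrary unions, so the sets
  with open traces form a topology for which the inclusions are continuous. The finest such
  topology therefore contains all of them.
\<close>

lemma openin_finest_topology_iff:
  fixes X :: "'i \<Rightarrow> 'a::ab_group_add set"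
  assumes fin: "finest_topology (inclusions_continuous I X N) T"
    and carrier: "\<And>\<alpha>. \<alpha> \<in> I \<Longrightarrow> topspace (norm_topology (X \<alpha>) (N \<alpha>)) = X \<alpha>"
  shows "openin T U \<longleftrightarrow> (\<forall>\<alpha>\<in>I. openin (norm_topology (X \<alpha>) (N \<alpha>)) (U \<inter> X \<alpha>))"
proof
  assume U: "openin T U"
  show "\<forall>\<alpha>\<in>I. openin (norm_topology (X \<alpha>) (N \<alpha>)) (U \<inter> X \<alpha>)"
  proof
    fix \<alpha> assume \<alpha>: "\<alpha> \<in> I"
    then have "continuous_map (norm_topology (X \<alpha>) (N \<alpha>)) T (\<lambda>x. x)"
      using fin by (simp add: finest_topology_def inclusions_continuous_def)
    from openin_continuous_map_preimage[OF this U]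
    show "openin (norm_topology (X \<alpha>) (N \<alpha>)) (U \<inter> X \<alpha>)"
      by (simp add: carrier[OF \<alpha>] Collect_conj_eq Int_commute)
  qed
next
  assume U: "\<forall>\<alpha>\<in>I. openin (norm_topology (X \<alpha>) (N \<alpha>)) (U \<inter> X \<alpha>)"
  let ?P = "\<lambda>U. \<forall>\<alpha>\<in>I. openin (norm_topology (X \<alpha>) (N \<alpha>)) (U \<inter> X \<alpha>)"
  have "istopology ?P"
    unfolding istopology_def
  proof (intro conjI allI impI ballI)
    fix V W \<alpha> assume VW: "?P V" "?P W" "\<alpha> \<in> I"
    have "V \<inter> W \<inter> X \<alpha> = (V \<inter> X \<alpha>) \<inter> (W \<inter> X \<alpha>)" by blast
    then show "openin (norm_topology (X \<alpha>) (N \<alpha>)) (V \<inter> W \<inter> X \<alpha>)"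
      using VW by (simp add: openin_Int)
  next
    fix \<K> \<alpha> assume K: "\<forall>K\<in>\<K>. ?P K" and \<alpha>: "\<alpha> \<in> I"
    have "openin (norm_topology (X \<alpha>) (N \<alpha>)) (\<Union>K\<in>\<K>. K \<inter> X \<alpha>)"
      using K \<alpha> by (intro openin_Union) blast
    then show "openin (norm_topology (X \<alpha>) (N \<alpha>)) (\<Union>\<K> \<inter> X \<alpha>)"
      by (simp only: Int_Union2)
  qed
  then have op: "openin (topology ?P) = ?P" by (rule topology_inverse')
  have "openin (norm_topology (X \<alpha>) (N \<alpha>)) (UNIV \<inter> X \<alpha>)" if "\<alpha> \<in> I" for \<alpha>
    using openin_topspace[of "norm_topology (X \<alpha>) (N \<alpha>)"] carrier[OF that] by simp
  then have "openin (topology ?P) UNIV" unfolding op by blast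
  then have top: "topspace (topology ?P) = UNIV"
    using openin_subset by blast
  have "inclusions_continuous I X N (topology ?P)"
    using top op by (auto simp: inclusions_continuous_def continuous_map_def carrier
        Collect_conj_eq Int_commute)
  moreover have "openin (topology ?P) U" unfolding op by (rule U)
  ultimately show "openin T U" using fin unfolding finest_topology_def by blast
qed

text \<open>
  The axiom \<open>coarser\<close> speaks of topologies only. Since norms are homogeneous, a
  comparison of the topologies at the origin already is a comparison of the norms up to a
  constant.
\<close>

lemma (in banach_inductive_limit) inclusion_bounded:
  assumes \<alpha>: "\<alpha> \<in> I" and \<beta>: "\<beta> \<in> I" and le: "X \<alpha> \<subseteq> X \<beta>"
  obtains K where "K > 0" "\<And>x. x \<in> X \<alpha> \<Longrightarrow> N \<beta> x \<le> K * N \<alpha> x"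
proof -
  note op = openin_norm_topology[OF vector_space_axioms banach]
  have s\<alpha>: "subspace (X \<alpha>)" "\<And>x. x \<in> X \<alpha> \<Longrightarrow> 0 \<le> N \<alpha> x \<and> (N \<alpha> x = 0 \<longleftrightarrow> x = 0)"
    "\<And>c x. x \<in> X \<alpha> \<Longrightarrow> N \<alpha> (smul c x) = norm c * N \<alpha> x"
    using banach[OF \<alpha>] by (auto simp: banach_on_def)
  have s\<beta>: "subspace (X \<beta>)" "\<And>x. x \<in> X \<beta> \<Longrightarrow> 0 \<le> N \<beta> x \<and> (N \<beta> x = 0 \<longleftrightarrow> x = 0)"
    "\<And>c x. x \<in> X \<beta> \<Longrightarrow> N \<beta> (smul c x) = norm c * N \<beta> x"
    "\<And>x y. x \<in> X \<beta> \<Longrightarrow> y \<in> X \<beta> \<Longrightarrow> N \<beta> (x + y) \<le> N \<beta> x + N \<beta> y"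
    using banach[OF \<beta>] by (auto simp: banach_on_def)
  let ?B = "{x \<in> X \<beta>. N \<beta> x < 1}"
  have "openin (norm_topology (X \<beta>) (N \<beta>)) ?B"
    unfolding op[OF \<beta>]
  proof (intro conjI ballI)
    fix x assume x: "x \<in> ?B"
    have "x + d \<in> ?B" if "d \<in> X \<beta>" "N \<beta> d < 1 - N \<beta> x" for d
      using x that s\<beta>(4)[of x d] subspace_add[OF s\<beta>(1)] by auto
    then show "\<exists>r>0. \<forall>d\<in>X \<beta>. N \<beta> d < r \<longrightarrow> x + d \<in> ?B"
      using x by (intro exI[of _ "1 - N \<beta> x"]) auto
  qed auto
  then have "openin (subtopology (norm_topology (X \<beta>) (N \<beta>)) (X \<alpha>)) (?B \<inter> X \<alpha>)"
    by (auto simp: openin_subtopology)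
  then have "openin (norm_topology (X \<alpha>) (N \<alpha>)) (?B \<inter> X \<alpha>)"
    by (rule coarser[OF \<alpha> \<beta> le])
  moreover have "0 \<in> ?B \<inter> X \<alpha>"
    using subspace_0[OF s\<alpha>(1)] subspace_0[OF s\<beta>(1)] s\<beta>(2)[of 0] by auto
  ultimately obtain r where "r > 0" and "\<forall>d\<in>X \<alpha>. N \<alpha> d < r \<longrightarrow> 0 + d \<in> ?B \<inter> X \<alpha>"
    unfolding op[OF \<alpha>] by blast
  then have r: "r > 0" "\<And>d. d \<in> X \<alpha> \<Longrightarrow> N \<alpha> d < r \<Longrightarrow> N \<beta> d < 1" by auto
  show ?thesis
  proof (rule that[of "2 / r"])
    show "2 / r > 0" using r by simp
    fix x assume x: "x \<in> X \<alpha>"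
    show "N \<beta> x \<le> 2 / r * N \<alpha> x"
    proof (cases "x = 0")
      case True
      then show ?thesis using s\<alpha>(2)[OF x] s\<beta>(2)[of x] le x by auto
    next
      case False
      then have pos: "N \<alpha> x > 0" using s\<alpha>(2)[OF x] by linarith
      define t where "t = r / (2 * N \<alpha> x)"
      have t: "t > 0" using pos r by (simp add: t_def)
      have "N \<alpha> (smul (of_real t) x) = t * N \<alpha> x"
        using s\<alpha>(3)[OF x] t by simp
      also have "\<dots> < r" using pos r by (simp add: t_def)
      finally have "N \<alpha> (smul (of_real t) x) < r" .
      then have "N \<beta> (smul (of_real t) x) < 1"
        using r(2) subspace_scale[OF s\<alpha>(1) x] by blast
      then have "t * N \<beta> x < 1" using s\<beta>(3) x le t by auto
      then show ?thesis using pos r by (simp add: t_def field_simps)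
    qed
  qed
qed

section \<open>Inverses of perturbed elements\<close>

text \<open>
  Banach's fixed point theorem for \<open>z \<mapsto> b - L z\<close>. The bound follows from
  \<open>\<parallel>z - b\<parallel> = \<parallel>L z\<parallel> \<le> \<rho> (\<parallel>z - b\<parallel> + \<parallel>b\<parallel>)\<close> and \<open>1 - \<rho> \<ge> 1/2\<close>.
\<close>

lemma affine_contraction_fixpoint:
  fixes smul :: "'k::real_normed_field \<Rightarrow> 'a::ab_group_add \<Rightarrow> 'a"
  assumes vs: "vector_space smul" and bn: "banach_on smul S n"
    and b: "b \<in> S" and \<rho>: "0 \<le> \<rho>" "\<rho> \<le> 1/2"
    and L: "\<And>x. x \<in> S \<Longrightarrow> L x \<in> S" "\<And>x. x \<in> S \<Longrightarrow> n (L x) \<le> \<rho> * n x"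
    and diff: "\<And>x y. L (x - y) = L x - L y"
  obtains z where "z \<in> S" "z = b - L z" "n (z - b) \<le> 2 * \<rho> * n b"
proof -
  interpret vector_space smul by (rule vs)
  interpret M: Metric_space S "norm_dist S n" by (rule Metric_space_norm_dist[OF vs bn])
  have sub: "subspace S" and hom: "\<And>c x. x \<in> S \<Longrightarrow> n (smul c x) = norm c * n x"
    and nn: "\<And>x. x \<in> S \<Longrightarrow> 0 \<le> n x"
    and tri: "\<And>x y. x \<in> S \<Longrightarrow> y \<in> S \<Longrightarrow> n (x + y) \<le> n x + n y"
    and compl: "M.mcomplete"
    using bn by (auto simp: banach_on_def)
  have minus: "n (- x) = n x" if "x \<in> S" for x
    using hom[of x "-1"] that by simp
  note dS = subspace_diff[OF sub]
  have "\<exists>z. z \<in> S \<and> b - L z = z"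
  proof (rule M.Banach_fixedpoint_thm[OF compl, of "\<lambda>z. b - L z" "\<rho>"])
    show "S \<noteq> {}" using b by blast
    show "(\<lambda>z. b - L z) \<in> S \<rightarrow> S" using b L dS by blast
    show "\<rho> < 1" using \<rho> by simp
    fix x y assume xy: "x \<in> S" "y \<in> S"
    have "n ((b - L x) - (b - L y)) = n (L (x - y))"
      using minus[OF L(1)[OF dS[OF xy]]] by (simp add: diff)
    also have "\<dots> \<le> \<rho> * n (x - y)" using L(2)[OF dS[OF xy]] .
    finally show "norm_dist S n (b - L x) (b - L y) \<le> \<rho> * norm_dist S n x y"
      using xy b L dS by (simp add: norm_dist_def)
  qed blast
  then obtain z where z: "z \<in> S" "z = b - L z" by metis
  have zb: "z - b \<in> S" using dS z b by blast
  have "z - b = - L z" using arg_cong[OF z(2), of "\<lambda>w. w - b"] by simp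
  then have "n (z - b) = n (L z)" using minus L(1)[OF z(1)] by simp
  also have "\<dots> \<le> \<rho> * n z" using L(2) z(1) .
  also have "\<dots> \<le> \<rho> * (n (z - b) + n b)"
    using tri[OF zb b] \<rho> by (intro mult_left_mono) auto
  also have "\<dots> = \<rho> * n (z - b) + \<rho> * n b" by (simp add: distrib_left)
  also have "\<rho> * n (z - b) \<le> 1/2 * n (z - b)"
    using \<rho> nn[OF zb] by (intro mult_right_mono)
  finally have "n (z - b) \<le> 2 * \<rho> * n b" by simp
  with z show ?thesis by (rule that)
qed

lemma (in banach_inductive_limit) upper_bound:
  assumes "\<alpha> \<in> I" "\<beta> \<in> I"
  obtains \<gamma> where "\<gamma> \<in> I" "X \<alpha> \<subseteq> X \<gamma>" "X \<beta> \<subseteq> X \<gamma>"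
  using directed[OF assms] that by blast

text \<open>
  Two levels are needed: products of \<open>d\<close> and \<open>b\<close> must first land in some \<open>X \<beta>\<close>, because only
  multiplication by elements of a previously chosen \<open>X \<beta>\<close> acts boundedly on the steps \<open>X \<eta>\<close> beyond
  \<open>h(\<beta>)\<close>. The choice of \<open>\<eta>\<close> and of the constant does not depend on \<open>d\<close>.
\<close>

lemma (in unital_strong_algebra) inverse_of_perturbation:
  assumes ab: "a * b = e" and ba: "b * a = e" and \<alpha>: "\<alpha> \<in> I"
  obtains \<eta> M where "\<eta> \<in> I" "b \<in> X \<eta>" "M > 0"
    "\<And>d. d \<in> X \<alpha> \<Longrightarrow> M * N \<alpha> d \<le> 1/2 \<Longrightarrow>
      \<exists>z. (a + d) * z = e \<and> z * (a + d) = e \<and>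
        z - b \<in> X \<eta> \<and> N \<eta> (z - b) \<le> 2 * (M * N \<alpha> d) * N \<eta> b"
proof -
  have nonneg: "0 \<le> N \<delta> x" if "\<delta> \<in> I" "x \<in> X \<delta>" for \<delta> x
    using banach[OF that(1)] that(2) by (auto simp: banach_on_def)
  have sub: "subspace (X \<delta>)" if "\<delta> \<in> I" for \<delta>
    using banach[OF that] by (auto simp: banach_on_def)
  obtain \<gamma> where \<gamma>: "\<gamma> \<in> I" "b \<in> X \<gamma>" using union by blast
  obtain h where h: "h \<in> I" and h_step: "\<And>\<beta>. \<beta> \<in> I \<Longrightarrow> X h \<subseteq> X \<beta> \<Longrightarrow>
      \<exists>C>0. \<forall>a\<in>X \<gamma>. \<forall>b\<in>X \<beta>.
        a * b \<in> X \<beta> \<and> N \<beta> (a * b) \<le> C * N \<gamma> a * N \<beta> b \<and>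
        b * a \<in> X \<beta> \<and> N \<beta> (b * a) \<le> C * N \<gamma> a * N \<beta> b"
    using strong[OF \<gamma>(1)] by blast
  obtain \<beta> where \<beta>: "\<beta> \<in> I" "X h \<subseteq> X \<beta>" "X \<alpha> \<subseteq> X \<beta>" using upper_bound[OF h \<alpha>] .
  obtain C where C: "C > 0" "\<And>x y. x \<in> X \<gamma> \<Longrightarrow> y \<in> X \<beta> \<Longrightarrow>
        x * y \<in> X \<beta> \<and> N \<beta> (x * y) \<le> C * N \<gamma> x * N \<beta> y \<and>
        y * x \<in> X \<beta> \<and> N \<beta> (y * x) \<le> C * N \<gamma> x * N \<beta> y"
    using h_step[OF \<beta>(1,2)] by blast
  obtain K where K: "K > 0" "\<And>x. x \<in> X \<alpha> \<Longrightarrow> N \<beta> x \<le> K * N \<alpha> x"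
    using inclusion_bounded[OF \<alpha> \<beta>(1,3)] by blast
  obtain k where k: "k \<in> I" and k_step: "\<And>\<eta>. \<eta> \<in> I \<Longrightarrow> X k \<subseteq> X \<eta> \<Longrightarrow>
      \<exists>C>0. \<forall>a\<in>X \<beta>. \<forall>b\<in>X \<eta>.
        a * b \<in> X \<eta> \<and> N \<eta> (a * b) \<le> C * N \<beta> a * N \<eta> b \<and>
        b * a \<in> X \<eta> \<and> N \<eta> (b * a) \<le> C * N \<beta> a * N \<eta> b"
    using strong[OF \<beta>(1)] by blast
  obtain \<eta> where \<eta>: "\<eta> \<in> I" "X k \<subseteq> X \<eta>" "X \<gamma> \<subseteq> X \<eta>" using upper_bound[OF k \<gamma>(1)] .
  obtain D where D: "D > 0" "\<And>x y. x \<in> X \<beta> \<Longrightarrow> y \<in> X \<eta> \<Longrightarrow>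
        x * y \<in> X \<eta> \<and> N \<eta> (x * y) \<le> D * N \<beta> x * N \<eta> y \<and>
        y * x \<in> X \<eta> \<and> N \<eta> (y * x) \<le> D * N \<beta> x * N \<eta> y"
    using k_step[OF \<eta>(1,2)] by blast
  have b: "b \<in> X \<eta>" using \<gamma> \<eta> by blast
  \<comment> \<open>The summand 1 only serves to make the constant positive when \<open>b = 0\<close>.\<close>
  define M where "M = D * (C * (N \<gamma> b + 1) * K)"
  have b0: "0 \<le> N \<gamma> b" using nonneg \<gamma> by blast
  have M: "M > 0" using C(1) D(1) K(1) b0 by (simp add: M_def add_nonneg_pos)
  have "\<exists>z. (a + d) * z = e \<and> z * (a + d) = e \<and>
        z - b \<in> X \<eta> \<and> N \<eta> (z - b) \<le> 2 * (M * N \<alpha> d) * N \<eta> b"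
    if d: "d \<in> X \<alpha>" and small: "M * N \<alpha> d \<le> 1/2" for d
  proof -
    let ?\<rho> = "M * N \<alpha> d"
    have \<rho>: "0 \<le> ?\<rho>" using M nonneg[OF \<alpha> d] by simp
    have d\<beta>: "d \<in> X \<beta>" using d \<beta> by blast
    have "C * N \<gamma> b * N \<beta> d \<le> C * (N \<gamma> b + 1) * (K * N \<alpha> d)"
      using C(1) b0 K(2)[OF d] nonneg[OF \<beta>(1) d\<beta>] by (intro mult_mono) auto
    then have bound: "D * (C * N \<gamma> b * N \<beta> d) \<le> ?\<rho>"
      using D(1) by (simp add: M_def mult.assoc mult_left_mono)
    have small_mult: "x * y \<in> X \<eta> \<and> N \<eta> (x * y) \<le> ?\<rho> * N \<eta> y \<and>
        y * x \<in> X \<eta> \<and> N \<eta> (y * x) \<le> ?\<rho> * N \<eta> y"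
      if x: "x \<in> X \<beta>" "N \<beta> x \<le> C * N \<gamma> b * N \<beta> d" and y: "y \<in> X \<eta>" for x y
    proof -
      have "D * N \<beta> x \<le> ?\<rho>"
        using order_trans[OF mult_left_mono[OF x(2), of D] bound] D(1) by simp
      then have "D * N \<beta> x * N \<eta> y \<le> ?\<rho> * N \<eta> y"
        using nonneg[OF \<eta>(1) y] by (rule mult_right_mono)
      then show ?thesis using D(2)[OF x(1) y] by linarith
    qed
    note bd = small_mult[of "b * d"] and db = small_mult[of "d * b"]
    have cs: "b * d \<in> X \<beta>" "N \<beta> (b * d) \<le> C * N \<gamma> b * N \<beta> d"
      "d * b \<in> X \<beta>" "N \<beta> (d * b) \<le> C * N \<gamma> b * N \<beta> d"
      using C(2)[OF \<gamma>(2) d\<beta>] by auto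
    obtain z where z: "z \<in> X \<eta>" "z = b - (b * d) * z" "N \<eta> (z - b) \<le> 2 * ?\<rho> * N \<eta> b"
      by (rule affine_contraction_fixpoint[OF vector_space_axioms banach[OF \<eta>(1)] b \<rho> small,
            of "\<lambda>z. (b * d) * z"]) (use bd cs in \<open>auto simp: right_diff_distrib\<close>)
    obtain w where w: "w \<in> X \<eta>" "w = b - w * (d * b)"
      by (rule affine_contraction_fixpoint[OF vector_space_axioms banach[OF \<eta>(1)] b \<rho> small,
            of "\<lambda>z. z * (d * b)"]) (use db cs in \<open>auto simp: left_diff_distrib\<close>)
    have "a * z = a * b - (a * b) * d * z"
      by (subst z(2)) (simp add: right_diff_distrib mult.assoc)
    then have right: "(a + d) * z = e"
      by (simp add: ab unit_left distrib_right)
    have "w * a = b * a - w * d * (b * a)"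
      by (subst w(2)) (simp add: left_diff_distrib mult.assoc)
    then have left: "w * (a + d) = e"
      by (simp add: ba unit_right distrib_left)
    have "w = w * ((a + d) * z)" by (simp add: right unit_right)
    also have "\<dots> = z" by (simp add: left unit_left flip: mult.assoc)
    finally have "w = z" .
    with right left z b show ?thesis
      using subspace_diff[OF sub[OF \<eta>(1)]] by blast
  qed
  with \<eta>(1) b M show ?thesis by (rule that)
qed

section \<open>Inversion in the limit topology\<close>

lemma (in unital_strong_algebra) inverse_wrt_eq:
  assumes "a * b = e" "b * a = e"
  shows "inverse_wrt e a = b"
  unfolding inverse_wrt_def
proof (rule the_equality)
  fix c assume c: "a * c = e \<and> c * a = e"
  have "c = (c * a) * b" using assms(1) by (simp add: mult.assoc unit_right)
  then show "c = b" using c by (simp add: unit_left)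
qed (use assms in auto)

text \<open>
  Openness of \<^term>\<open>GL e\<close> is the case \<open>V = UNIV\<close>, so this single statement carries both halves of
  the theorem.
\<close>

lemma (in unital_strong_algebra) openin_inverse_preimage:
  assumes fin: "finest_topology (inclusions_continuous I X N) T"
    and V: "openin T V"
  shows "openin T {x \<in> GL e. inverse_wrt e x \<in> V}"
proof -
  note op = openin_norm_topology[OF vector_space_axioms banach]
  have carrier: "topspace (norm_topology (X \<alpha>) (N \<alpha>)) = X \<alpha>" if "\<alpha> \<in> I" for \<alpha>
    using Metric_space.topspace_mtopology[OF Metric_space_norm_dist[OF vector_space_axioms
          banach[OF that]]] by (simp add: norm_topology_def)
  note T_iff = openin_finest_topology_iff[OF fin carrier]
  let ?W = "{x \<in> GL e. inverse_wrt e x \<in> V}"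
  have "\<exists>r>0. \<forall>d\<in>X \<alpha>. N \<alpha> d < r \<longrightarrow> a + d \<in> ?W \<inter> X \<alpha>"
    if \<alpha>: "\<alpha> \<in> I" and a: "a \<in> ?W \<inter> X \<alpha>" for \<alpha> a
  proof -
    obtain b where b: "a * b = e" "b * a = e" using a by (auto simp: GL_def)
    have bV: "b \<in> V" using a inverse_wrt_eq[OF b] by simp
    obtain \<eta> M where \<eta>: "\<eta> \<in> I" "b \<in> X \<eta>" and M: "M > 0"
      and inv: "\<And>d. d \<in> X \<alpha> \<Longrightarrow> M * N \<alpha> d \<le> 1/2 \<Longrightarrow>
        \<exists>z. (a + d) * z = e \<and> z * (a + d) = e \<and>
          z - b \<in> X \<eta> \<and> N \<eta> (z - b) \<le> 2 * (M * N \<alpha> d) * N \<eta> b"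
      using inverse_of_perturbation[OF b \<alpha>] by metis
    have "openin (norm_topology (X \<eta>) (N \<eta>)) (V \<inter> X \<eta>)" using V \<eta>(1) T_iff by blast
    then obtain s where s: "s > 0" "\<And>c. c \<in> X \<eta> \<Longrightarrow> N \<eta> c < s \<Longrightarrow> b + c \<in> V"
      using bV \<eta>(2) unfolding op[OF \<eta>(1)] by blast
    have b0: "0 \<le> N \<eta> b" using banach[OF \<eta>(1)] \<eta>(2) by (auto simp: banach_on_def)
    \<comment> \<open>The first bound makes the contraction constant at most 1/2, the second one makes the
      distance of the inverses less than \<open>s\<close>.\<close>
    define r where "r = min (1 / (2 * M)) (s / (2 * M * (N \<eta> b + 1)))"
    have r: "r > 0" using M s(1) b0 by (simp add: r_def add_nonneg_pos)
    have "a + d \<in> ?W \<inter> X \<alpha>" if d: "d \<in> X \<alpha>" "N \<alpha> d < r" for d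
    proof -
      have d0: "0 \<le> N \<alpha> d" using banach[OF \<alpha>] d(1) by (auto simp: banach_on_def)
      have "N \<alpha> d < 1 / (2 * M)" using d(2) by (simp add: r_def)
      then have "M * N \<alpha> d \<le> 1/2" using M by (simp add: field_simps)
      then obtain z where z: "(a + d) * z = e" "z * (a + d) = e" "z - b \<in> X \<eta>"
        "N \<eta> (z - b) \<le> 2 * (M * N \<alpha> d) * N \<eta> b"
        using inv[OF d(1)] by blast
      have "2 * (M * N \<alpha> d) * N \<eta> b \<le> N \<alpha> d * (2 * M * (N \<eta> b + 1))"
        using M d0 by (simp add: algebra_simps)
      also have "\<dots> < s"
      proof -
        have "N \<alpha> d < s / (2 * M * (N \<eta> b + 1))" using d(2) by (simp add: r_def)
        moreover have "2 * M * (N \<eta> b + 1) > 0" using M b0 by simp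
        ultimately show ?thesis by (simp only: pos_less_divide_eq)
      qed
      finally have "b + (z - b) \<in> V" using s(2)[OF z(3)] z(4) by linarith
      then have "z \<in> V" by simp
      moreover have "a + d \<in> X \<alpha>"
        using a d(1) banach[OF \<alpha>] subspace_add by (auto simp: banach_on_def)
      ultimately show ?thesis
        using z(1,2) inverse_wrt_eq[OF z(1,2)] by (auto simp: GL_def)
    qed
    with r show ?thesis by blast
  qed
  then show ?thesis using T_iff op by simp
qed

theorem theorem4p4:
  fixes smul :: "'k::real_normed_field \<Rightarrow> 'a::ring \<Rightarrow> 'a"
    and I :: "'i set"
    and X :: "'i \<Rightarrow> 'a set"
    and N :: "'i \<Rightarrow> 'a \<Rightarrow> real"
    and T :: "'a topology"
    and e :: 'a
  assumes "unital_strong_algebra smul I X N T e"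
    and "finest_topology (inclusions_continuous I X N) T"
  shows "openin T (GL e) \<and>
    continuous_map (subtopology T (GL e)) (subtopology T (GL e)) (inverse_wrt e)"
proof -
  interpret unital_strong_algebra smul I X N T e by (rule assms(1))
  note pre = openin_inverse_preimage[OF assms(2)]
  have top: "topspace T = UNIV"
    using assms(2) by (simp add: finest_topology_def inclusions_continuous_def)
  have GL: "openin T (GL e)"
    using pre[of UNIV] openin_topspace[of T] top by simp
  have "inverse_wrt e x \<in> GL e" if "x \<in> GL e" for x
    using that inverse_wrt_eq by (fastforce simp: GL_def)
  moreover have "continuous_map (subtopology T (GL e)) T (inverse_wrt e)"
    unfolding continuous_map_def
    using pre GL by (auto simp: top openin_open_subtopology)
  ultimately show ?thesis
    using GL by (auto simp: continuous_map_in_subtopology top)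
qed

end
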